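(* Let $\widehat\Gamma=\left\langle\begin{pmatrix}1&4\\0&1\end{pmatrix},\begin{pmatrix}0&1\\-1&0\end{pmatrix}\right\rangle<\mathrm{PSL}(2,\mathbb{R})$, and let $\mathcal{A}_{T,\mathcal{I}}=\{x^1_{T,\mathcal{I}}<x^2_{T,\mathcal{I}}<\cdots\}$ and $\widehat F_{T,\mathcal{I}}$ be as in the context. For every closed interval $\mathcal{I}\subset[0,1]$ and every $0<s<2$, $\widehat F_{\mathcal{I}}(s):=\lim_{T\to\infty}\widehat F_{T,\mathcal{I}}(s)=0$. Moreover all (scaled) gaps are larger than $2$: $T(x^{j+1}_{T,\mathcal{I}}-x^j_{T,\mathcal{I}})>2$ for all $T$, all $\mathcal{I}$ and all $1\le j<\#\mathcal{A}_{T,\mathcal{I}}$.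
   Context: Circle configuration: $\mathcal{C}_0=\mathbb{R}$, $\mathcal{C}_1=\mathbb{R}+i$, $\mathcal{C}_2=C(i/2,1/2)$, $\mathcal{C}_3=C(4+i/2,1/2)$, where $C(z,r)$ is the circle with centre $z$ and radius $r$; $\mathcal{K}=\widehat\Gamma\{\mathcal{C}_0,\mathcal{C}_1,\mathcal{C}_2,\mathcal{C}_3\}$ (Möbius action on the closed upper half plane). $\mathcal{A}_T$ is the set of $x\in[0,1]$ such that a circle of $\mathcal{K}$ is tangent to $\mathcal{C}_0$ at $x$ and has diameter larger than $T^{-1}$ (a circle tangent at a reduced fraction $p/q$ has diameter $1/q^2$). For an interval $\mathcal{I}\subset[0,1]$, the elements of $\mathcal{A}_{T,\mathcal{I}}=\mathcal{A}_T\cap\mathcal{I}$ are listed in increasing order $x^1_{T,\mathcal{I}}<x^2_{T,\mathcal{I}}<\cdots$ and $$\widehat F_{T,\mathcal{I}}(s)=\frac{\#\{j\in[1,\#\mathcal{A}_{T,\mathcal{I}}):T(x^{j+1}_{T,\mathcal{I}}-x^j_{T,\mathcal{I}})\le s\}}{T^{\delta_{\widehat\Gamma}}},$$ where $\delta_{\widehat\Gamma}$ is the critical exponent of $\widehat\Gamma$. *)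

theory Defs
  imports
    "HOL-Analysis.Analysis"
    "HOL-Algebra.Coset"
    "HOL-Algebra.Generated_Groups"
begin

text \<open>The group \<open>PSL(2,\<real>)\<close>, as the quotient of \<open>SL(2,\<real>)\<close> by \<open>{I, -I}\<close>. Its elements
  are therefore the two-element sets \<open>{A, -A}\<close>.\<close>

definition mat2 :: "real \<Rightarrow> real \<Rightarrow> real \<Rightarrow> real \<Rightarrow> real^2^2" where
  "mat2 a b c d = vector [vector [a, b], vector [c, d]]"

definition SL2R :: "(real^2^2) monoid" where
  "SL2R = \<lparr>carrier = {A. det A = 1}, mult = (**), one = mat 1\<rparr>"

definition PSL2R :: "(real^2^2) set monoid" where
  "PSL2R = SL2R Mod {mat 1, - mat 1}"

definition psl :: "real^2^2 \<Rightarrow> (real^2^2) set" where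
  "psl A = {mat 1, - mat 1} #>\<^bsub>SL2R\<^esub> A"

definition Gamma_hat :: "(real^2^2) set set" where
  "Gamma_hat = generate PSL2R {psl (mat2 1 4 0 1), psl (mat2 0 1 (-1) 0)}"

text \<open>The Riemann sphere is \<open>complex option\<close>, with \<open>None\<close> as the point at infinity.\<close>

definition moebius :: "real^2^2 \<Rightarrow> complex option \<Rightarrow> complex option" where
  "moebius A p =
    (let a = of_real (A$1$1); b = of_real (A$1$2); c = of_real (A$2$1); d = of_real (A$2$2)
     in case p of
          None \<Rightarrow> if c = 0 then None else Some (a / c)
        | Some z \<Rightarrow> if c * z + d = 0 then None else Some ((a * z + b) / (c * z + d)))"

text \<open>All representatives of an element of \<open>PSL(2,\<real>)\<close> act in the same way, so the image
  below is a singleton.\<close>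

definition psl_act :: "(real^2^2) set \<Rightarrow> complex option \<Rightarrow> complex option" where
  "psl_act g p = the_elem ((\<lambda>A. moebius A p) ` g)"

lemma moebius_uminus: "moebius (- A) p = moebius A p"
proof (cases p)
  case None
  then show ?thesis by (simp add: moebius_def)
next
  case (Some z)
  have den: "- (of_real (A$2$1) * z) - of_real (A$2$2) = - (of_real (A$2$1) * z + of_real (A$2$2))"
    and num: "- (of_real (A$1$1) * z) - of_real (A$1$2) = - (of_real (A$1$1) * z + of_real (A$1$2))"
    by simp_all
  show ?thesis
    unfolding moebius_def Let_def Some option.case
    by (simp only: vector_uminus_component of_real_minus mult_minus_left add_uminus_conv_diff
        den num neg_equal_0_iff_equal minus_divide_divide)
qed

lemma psl_act_psl: "psl_act (psl A) p = moebius A p"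
proof -
  have "(- mat 1 :: real^2^2) ** A = - A"
    by (simp add: matrix_matrix_mult_def mat_def vec_eq_iff sum_negf if_distrib if_distribR
        cong: if_cong)
  then have "psl A = {A, - A}"
    by (auto simp: psl_def SL2R_def r_coset_def)
  then show ?thesis
    by (simp add: psl_act_def moebius_uminus)
qed

text \<open>The critical exponent is the abscissa of convergence of the Poincare series of the orbit
  of \<open>\<i>\<close>. The set below is non-empty for every discrete group, as it contains all \<open>s > 1\<close>.\<close>

definition hyp_dist :: "complex \<Rightarrow> complex \<Rightarrow> real" where
  "hyp_dist z w = arcosh (1 + (cmod (z - w))\<^sup>2 / (2 * Im z * Im w))"

definition critical_exponent :: "(real^2^2) set set \<Rightarrow> real" where
  "critical_exponent G =
    Inf {s. 0 \<le> s \<and>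
      (\<lambda>g. exp (- s * hyp_dist \<i> (the (psl_act g (Some \<i>))))) summable_on G}"

text \<open>Circles on the Riemann sphere; a horizontal line contains the point at infinity.\<close>

definition hline :: "real \<Rightarrow> complex option set" where
  "hline y = insert None (Some ` {z. Im z = y})"

definition circ :: "complex \<Rightarrow> real \<Rightarrow> complex option set" where
  "circ z r = Some ` sphere z r"

definition C0 :: "complex option set" where "C0 = hline 0"
definition C1 :: "complex option set" where "C1 = hline 1"
definition C2 :: "complex option set" where "C2 = circ (\<i> / 2) (1 / 2)"
definition C3 :: "complex option set" where "C3 = circ (4 + \<i> / 2) (1 / 2)"

definition packing :: "complex option set set" where
  "packing = {psl_act g ` C | g C. g \<in> Gamma_hat \<and> C \<in> {C0, C1, C2, C3}}"

text \<open>Two circles on the sphere are tangent iff they have exactly one point in common.\<close>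

definition tangent_at :: "complex option set \<Rightarrow> complex option set \<Rightarrow> complex option \<Rightarrow> bool" where
  "tangent_at C D p \<longleftrightarrow> C \<inter> D = {p}"

definition tangencies :: "real \<Rightarrow> real set" where
  "tangencies T = {x \<in> {0..1}. \<exists>z r. 0 < r \<and> circ z r \<in> packing \<and>
      tangent_at (circ z r) C0 (Some (of_real x)) \<and> 2 * r > 1 / T}"

definition tangencies_in :: "real \<Rightarrow> real set \<Rightarrow> real set" where
  "tangencies_in T I = tangencies T \<inter> I"

text \<open>The \<open>j\<close>-th smallest element, counting from \<open>1\<close>. It is meaningful for \<open>T > 0\<close> and
  \<open>1 \<le> j \<le> card (tangencies_in T I)\<close>; for \<open>T > 0\<close> the set is finite, since its elements are
  fractions whose denominator has square less than \<open>T\<close>.\<close>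

definition tangency :: "real \<Rightarrow> real set \<Rightarrow> nat \<Rightarrow> real" where
  "tangency T I j = sorted_list_of_set (tangencies_in T I) ! (j - 1)"

text \<open>The last index \<open>j = card (tangencies_in T I)\<close> has no successor, hence no gap, and is not
  counted.\<close>

definition gap_distr :: "real \<Rightarrow> real set \<Rightarrow> real \<Rightarrow> real" where
  "gap_distr T I s =
    real (card {j \<in> {1..<card (tangencies_in T I)}.
        T * (tangency T I (j + 1) - tangency T I j) \<le> s})
    / T powr critical_exponent Gamma_hat"

end

theory Submission
  imports Defs
begin

text \<open>Every tangency point is \<open>a/c\<close> for some matrix of the group with first column \<open>(a, c)\<close> and
  \<open>c\<^sup>2 < T\<close>. Two such points \<open>a/c\<close> and \<open>a'/c'\<close> differ by \<open>\<bar>k\<bar> / \<bar>c c'\<bar>\<close>, where \<open>k\<close> is the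
  lower left entry of a group element, hence an integer. The scaled gap exceeds \<open>\<bar>k\<bar>\<close>, which
  settles \<open>\<bar>k\<bar> \<ge> 2\<close>. If \<open>\<bar>k\<bar> = 1\<close>, then \<open>(c, \<plusminus>c')\<close> is itself the bottom row of a group element.
  Since translations are by multiples of \<open>4\<close>, in each bottom row one entry is at least twice as
  large as the other, so that \<open>2 \<bar>c c'\<bar> \<le> max c\<^sup>2 c'\<^sup>2 < T\<close>.\<close>

section \<open>Integer rows reached from \<open>(0, 1)\<close> by words in the two
  generators\<close>

section \<open>Bottom rows\<close>

text \<open>Up to sign, \<open>step\<close> multiplies the row from the right by the inversion and
  then by the \<open>n\<close>-th power of the translation by 4. These are thus the rows of words
  ending in a nontrivial translation, starting from the row \<open>(0, \<plusminus>1)\<close>, which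
  translations fix.\<close>

inductive dominant_row :: "int \<Rightarrow> int \<Rightarrow> bool" where
  base: "\<bar>e\<bar> = 1 \<Longrightarrow> dominant_row 0 e"
| step: "dominant_row c d \<Longrightarrow> n \<noteq> 0 \<Longrightarrow> dominant_row d (4 * n * d - c)"

text \<open>The second alternative covers words ending in an inversion: \<open>(- d, c)\<close> is
  \<open>(c, d)\<close> times the inversion matrix.\<close>

definition orbit_row :: "int \<Rightarrow> int \<Rightarrow> bool" where
  "orbit_row c d \<longleftrightarrow> dominant_row c d \<or> dominant_row (- d) c"

text \<open>The new entry is at least \<open>4 |d| - |c|\<close> in absolute value because
  \<open>n \<noteq> 0\<close>, and inductively \<open>|c|\<close> is at most \<open>|d| / 2\<close>;
  so the factor 2 survives each step.\<close>

lemma dominant_row_bound: "dominant_row c d \<Longrightarrow> 2 * \<bar>c\<bar> \<le> \<bar>d\<bar> \<and> d \<noteq> 0"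
proof (induction rule: dominant_row.induct)
  case (step c d n)
  have "4 * \<bar>d\<bar> \<le> \<bar>4 * n * d\<bar>"
    using step by (simp add: abs_mult)
  with step show ?case by linarith
qed auto

lemma dominant_row_uminus: "dominant_row c d \<Longrightarrow> dominant_row (- c) (- d)"
proof (induction rule: dominant_row.induct)
  case (step c d n)
  from dominant_row.step[OF step.IH step.hyps(2)] show ?case by simp
qed (auto intro: dominant_row.base)

lemma orbit_row_uminus: "orbit_row c d \<Longrightarrow> orbit_row (- c) (- d)"
  using dominant_row_uminus by (fastforce simp: orbit_row_def)

lemma orbit_row_swap: "orbit_row c d \<Longrightarrow> orbit_row (- d) c"
  using dominant_row_uminus by (auto simp: orbit_row_def)

text \<open>After a final translation, the exponents add; if they cancel, that step disappears and
  the word ends in an inversion. After a final inversion, the translation becomes a new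
  step.\<close>

lemma orbit_row_translate:
  assumes "orbit_row c d"
  shows "orbit_row c (d + 4 * n * c)"
proof (cases "dominant_row c d")
  case True
  then show ?thesis
  proof cases
    case base
    then show ?thesis by (simp add: orbit_row_def dominant_row.base)
  next
    case (step c' k)
    have eq: "d + 4 * n * c = 4 * (k + n) * c - c'"
      using step by (simp add: algebra_simps)
    show ?thesis
      unfolding eq using step(2) dominant_row.step[OF step(2), of "k + n"]
      by (cases "k + n = 0") (auto simp: orbit_row_def)
  qed
next
  case False
  then have dom: "dominant_row (- d) c"
    using assms by (simp add: orbit_row_def)
  show ?thesis
    using assms dominant_row.step[OF dom, of n]
    by (cases "n = 0") (auto simp: orbit_row_def add.commute)
qed

text \<open>By the factor 2, an entry of absolute value 1 dominates only 0. Hence either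
  \<open>d = 0\<close>, or the row before the last step was \<open>(0, c)\<close> and
  \<open>d = 4 * n * c\<close>.\<close>

lemma orbit_row_unit_dvd:
  assumes "orbit_row c d" "\<bar>c\<bar> = 1"
  shows "4 dvd d"
proof (cases "dominant_row c d")
  case True
  then show ?thesis
  proof cases
    case (step c' n)
    with assms(2) dominant_row_bound[of c' c] have "c' = 0" by linarith
    with step show ?thesis by simp
  qed (use assms in auto)
next
  case False
  then have "dominant_row (- d) c"
    using assms by (simp add: orbit_row_def)
  from dominant_row_bound[OF this] assms(2) show ?thesis by (cases "d = 0") auto
qed

lemma orbit_row_mult_less:
  fixes T :: real
  assumes "orbit_row c d" "(of_int c)\<^sup>2 < T" "(of_int d)\<^sup>2 < T"
  shows "2 * \<bar>of_int c * of_int d\<bar> < T"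
proof -
  have "2 * \<bar>c * d\<bar> \<le> max (c\<^sup>2) (d\<^sup>2)"
  proof -
    have "2 * \<bar>c\<bar> \<le> \<bar>d\<bar> \<or> 2 * \<bar>d\<bar> \<le> \<bar>c\<bar>"
      using assms(1) dominant_row_bound[of c d] dominant_row_bound[of "- d" c]
      by (auto simp: orbit_row_def)
    then have "2 * \<bar>c\<bar> * \<bar>d\<bar> \<le> \<bar>d\<bar> * \<bar>d\<bar> \<or> 2 * \<bar>d\<bar> * \<bar>c\<bar> \<le> \<bar>c\<bar> * \<bar>c\<bar>"
      using mult_right_mono[OF _ abs_ge_zero] by blast
    then show ?thesis
      by (auto simp: abs_mult power2_eq_square le_max_iff_disj ac_simps)
  qed
  then have "real_of_int (2 * \<bar>c * d\<bar>) \<le> of_int (max (c\<^sup>2) (d\<^sup>2))"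
    by (simp only: of_int_le_iff)
  also have "\<dots> < T"
    using assms(2,3) by (auto simp: max_def)
  finally show ?thesis by simp
qed

section \<open>The group lifted to SL(2,R), its bottom rows, and the estimate for two of its
  elements\<close>

section \<open>The matrix group\<close>

lemma mat2_nth [simp]:
  "mat2 a b c d $ 1 $ 1 = a" "mat2 a b c d $ 1 $ 2 = b"
  "mat2 a b c d $ 2 $ 1 = c" "mat2 a b c d $ 2 $ 2 = d"
  by (simp_all add: mat2_def)

lemma mat2_eq_iff [simp]:
  "mat2 a b c d = mat2 a' b' c' d' \<longleftrightarrow> a = a' \<and> b = b' \<and> c = c' \<and> d = d'"
  by (metis mat2_nth)

lemma mat2_mult:
  "mat2 a b c d ** mat2 a' b' c' d' =
    mat2 (a * a' + b * c') (a * b' + b * d') (c * a' + d * c') (c * b' + d * d')"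
  by (simp add: vec_eq_iff forall_2 matrix_matrix_mult_def sum_2)

lemma mat_1_eq_mat2: "mat 1 = mat2 1 0 0 1"
  by (simp add: vec_eq_iff forall_2 mat_def)

lemma det_mat2 [simp]: "det (mat2 a b c d) = a * d - b * c"
  by (simp add: det_2)

lemma group_SL2R: "group SL2R"
proof (rule groupI)
  fix A assume "A \<in> carrier SL2R"
  then have A: "det A = 1" by (simp add: SL2R_def)
  then obtain B where "B ** A = mat 1"
    using invertible_det_nz[of A] by (auto simp: invertible_def)
  moreover from this have "det B = 1"
    by (metis A det_I det_mul mult.right_neutral)
  ultimately show "\<exists>B\<in>carrier SL2R. B \<otimes>\<^bsub>SL2R\<^esub> A = \<one>\<^bsub>SL2R\<^esub>"
    by (auto simp: SL2R_def)
qed (auto simp: SL2R_def det_mul matrix_mul_assoc)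

lemma inv_SL2R_mat2:
  assumes "a * d - b * c = 1"
  shows "inv\<^bsub>SL2R\<^esub> (mat2 a b c d) = mat2 d (- b) (- c) a"
proof -
  interpret group SL2R by (rule group_SL2R)
  show ?thesis
    by (rule inv_equality)
      (use assms in \<open>simp_all add: SL2R_def mat2_mult mat_1_eq_mat2 algebra_simps\<close>)
qed

lemma uminus_mat2: "- mat2 a b c d = mat2 (- a) (- b) (- c) (- d)"
  by (simp add: vec_eq_iff forall_2)

lemma normal_center_SL2R: "{mat 1, - mat 1} \<lhd> SL2R"
proof -
  interpret group SL2R by (rule group_SL2R)
  have "subgroup {mat 1, - mat 1} SL2R"
  proof (rule subgroupI)
    show "inv\<^bsub>SL2R\<^esub> A \<in> {mat 1, - mat 1}" if "A \<in> {mat 1, - mat 1}" for A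
      using that by (auto simp: mat_1_eq_mat2 uminus_mat2 inv_SL2R_mat2)
  qed (auto simp: SL2R_def mat_1_eq_mat2 uminus_mat2 mat2_mult)
  moreover have "A ** - mat 1 = - mat 1 ** A" for A :: "real^2^2"
    by (simp add: vec_eq_iff forall_2 matrix_matrix_mult_def sum_2 mat_def)
  ultimately show ?thesis
    by (auto simp: normal_def normal_axioms_def is_group r_coset_def l_coset_def) (simp_all add: SL2R_def)
qed

definition Gamma_mat :: "(real^2^2) set" where
  "Gamma_mat = generate SL2R {mat2 1 4 0 1, mat2 0 1 (-1) 0}"

text \<open>The quotient map is a homomorphism, so it sends the subgroup generated by the two
  matrices onto the one generated by their classes. From here on, actual matrix entries are
  available.\<close>

lemma Gamma_hat_eq: "Gamma_hat = psl ` Gamma_mat"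
proof -
  interpret N: normal "{mat 1, - mat 1}" SL2R by (rule normal_center_SL2R)
  interpret group_hom SL2R PSL2R psl
    using N.r_coset_hom_Mod N.factorgroup_is_group N.is_group
    unfolding psl_def PSL2R_def group_hom_def group_hom_axioms_def by simp
  have "{mat2 1 4 0 1, mat2 0 1 (-1) 0} \<subseteq> carrier SL2R"
    by (simp add: SL2R_def)
  from generate_img[OF this] show ?thesis
    by (simp add: Gamma_hat_def Gamma_mat_def)
qed

lemma subgroup_Gamma_mat: "subgroup Gamma_mat SL2R"
  unfolding Gamma_mat_def
  by (rule group.generate_is_subgroup[OF group_SL2R]) (simp add: SL2R_def)

lemma translation_in_Gamma_mat: "mat2 1 4 0 1 \<in> Gamma_mat"
  and inversion_in_Gamma_mat: "mat2 0 1 (-1) 0 \<in> Gamma_mat"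
  unfolding Gamma_mat_def by (auto intro: generate.incl)

lemma Gamma_mat_mult: "A \<in> Gamma_mat \<Longrightarrow> B \<in> Gamma_mat \<Longrightarrow> A ** B \<in> Gamma_mat"
  using subgroup.m_closed[OF subgroup_Gamma_mat] by (simp add: SL2R_def)

text \<open>The claim concerns the action on all orbit rows, not just the bottom row of
  \<open>A\<close>, because the induction multiplies two arbitrary group elements: the action
  composes, whereas knowing the two bottom rows would not suffice.\<close>

lemma Gamma_mat_preserves_orbit_rows:
  assumes "A \<in> Gamma_mat"
  shows "\<exists>a b c d :: int. A = mat2 (of_int a) (of_int b) (of_int c) (of_int d) \<and> a * d - b * c = 1
    \<and> (\<forall>x y. orbit_row x y \<longrightarrow> orbit_row (x * a + y * c) (x * b + y * d))"
  using assms unfolding Gamma_mat_def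
proof (induction rule: generate.induct)
  case one
  have "\<one>\<^bsub>SL2R\<^esub> = mat2 (of_int 1) (of_int 0) (of_int 0) (of_int 1)"
    by (simp add: SL2R_def mat_1_eq_mat2)
  then show ?case
    by (intro exI[of _ 1] exI[of _ 0]) simp
next
  case (incl h)
  then consider
      "h = mat2 (of_int 1) (of_int 4) (of_int 0) (of_int 1)"
    | "h = mat2 (of_int 0) (of_int 1) (of_int (-1)) (of_int 0)"
    by auto
  then show ?case
  proof cases
    case 1
    then show ?thesis
      using orbit_row_translate[of _ _ 1]
      by (intro exI[of _ 1] exI[of _ 4] exI[of _ 0]) (simp add: algebra_simps)
  next
    case 2
    then show ?thesis
      using orbit_row_swap
      by (intro exI[of _ 0] exI[of _ 1] exI[of _ "-1"] exI[of _ 0]) simp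
  qed
next
  case (inv h)
  then consider
      "inv\<^bsub>SL2R\<^esub> h = mat2 (of_int 1) (of_int (-4)) (of_int 0) (of_int 1)"
    | "inv\<^bsub>SL2R\<^esub> h = mat2 (of_int 0) (of_int (-1)) (of_int 1) (of_int 0)"
    by (auto simp: inv_SL2R_mat2)
  then show ?case
  proof cases
    case 1
    then show ?thesis
      using orbit_row_translate[of _ _ "-1"]
      by (intro exI[of _ 1] exI[of _ "-4"] exI[of _ 0]) (simp add: algebra_simps)
  next
    case 2
    \<comment> \<open>The inverse of the inversion matrix is its negative: swap, then change
      signs.\<close>
    have "orbit_row y (- x)" if "orbit_row x y" for x y
      using orbit_row_uminus[OF orbit_row_swap[OF that]] by simp
    with 2 show ?thesis
      by (intro exI[of _ 0] exI[of _ "-1"] exI[of _ 1] exI[of _ 0]) simp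
  qed
next
  case (eng h1 h2)
  from eng.IH(1) obtain a b c d :: int where 1:
    "h1 = mat2 (of_int a) (of_int b) (of_int c) (of_int d)" "a * d - b * c = 1"
    "\<And>x y. orbit_row x y \<Longrightarrow> orbit_row (x * a + y * c) (x * b + y * d)"
    by blast
  from eng.IH(2) obtain a' b' c' d' :: int where 2:
    "h2 = mat2 (of_int a') (of_int b') (of_int c') (of_int d')" "a' * d' - b' * c' = 1"
    "\<And>x y. orbit_row x y \<Longrightarrow> orbit_row (x * a' + y * c') (x * b' + y * d')"
    by blast
  have "(a * a' + b * c') * (c * b' + d * d') - (a * b' + b * d') * (c * a' + d * c')
      = (a * d - b * c) * (a' * d' - b' * c')"
    by (simp add: algebra_simps)
  moreover have "orbit_row (x * (a * a' + b * c') + y * (c * a' + d * c'))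
      (x * (a * b' + b * d') + y * (c * b' + d * d'))" if "orbit_row x y" for x y
    using 2(3)[OF 1(3)[OF that]] by (simp add: algebra_simps)
  ultimately show ?case
    using 1(2) 2(2)
    by (intro exI[of _ "a * a' + b * c'"] exI[of _ "a * b' + b * d'"]
        exI[of _ "c * a' + d * c'"] exI[of _ "c * b' + d * d'"])
      (simp add: 1(1) 2(1) SL2R_def mat2_mult)
qed

lemma Gamma_mat_integral:
  assumes "A \<in> Gamma_mat"
  obtains a b c d :: int where "A = mat2 (of_int a) (of_int b) (of_int c) (of_int d)"
    "a * d - b * c = 1" "orbit_row c d"
proof -
  \<comment> \<open>The bottom row of a matrix is the image of \<open>(0, 1)\<close> under
    it.\<close>
  have "orbit_row 0 1"
    by (simp add: orbit_row_def dominant_row.base)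
  with Gamma_mat_preserves_orbit_rows[OF assms] show ?thesis
    using that by fastforce
qed

lemma Gamma_mat_orbit_row:
  assumes "mat2 (of_int a) (of_int b) (of_int c) (of_int d) \<in> Gamma_mat"
  shows "a * d - b * c = 1" "orbit_row c d"
  using Gamma_mat_integral[OF assms] by (metis mat2_eq_iff of_int_eq_iff)+

lemma Gamma_mat_adjugate:
  assumes "mat2 (of_int a) (of_int b) (of_int c) (of_int d) \<in> Gamma_mat"
  shows "mat2 (of_int d) (of_int (- b)) (of_int (- c)) (of_int a) \<in> Gamma_mat"
proof -
  have "real_of_int (a * d - b * c) = 1"
    using Gamma_mat_orbit_row(1)[OF assms] by simp
  then show ?thesis
    using subgroup.m_inv_closed[OF subgroup_Gamma_mat assms] by (simp add: inv_SL2R_mat2)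
qed

text \<open>For nonzero \<open>c\<close> and \<open>c'\<close>, division by \<open>|c * c'|\<close>
  turns this into a scaled distance greater than 2 between \<open>a / c\<close> and
  \<open>a' / c'\<close>.\<close>

lemma Gamma_mat_gap:
  fixes a b c d a' b' c' d' :: int and T :: real
  assumes A: "mat2 (of_int a) (of_int b) (of_int c) (of_int d) \<in> Gamma_mat"
    and B: "mat2 (of_int a') (of_int b') (of_int c') (of_int d') \<in> Gamma_mat"
    and T: "(of_int c)\<^sup>2 < T" "(of_int c')\<^sup>2 < T"
    and ne: "a * c' \<noteq> a' * c"
  shows "2 * \<bar>of_int c * of_int c'\<bar> < T * \<bar>of_int (a * c' - a' * c)\<bar>"
proof -
  \<comment> \<open>\<open>(l, k)\<close> is the first column of the inverse of the first matrix
    times the second; inverting this product gives the bottom row \<open>(- k, l)\<close>.\<close>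
  define k where "k = a * c' - a' * c"
  define l where "l = d * a' - b * c'"
  have det: "a * d - b * c = 1"
    using Gamma_mat_orbit_row(1)[OF A] .
  have "mat2 (of_int l) (of_int (d * b' - b * d')) (of_int k) (of_int (a * d' - c * b')) \<in> Gamma_mat"
    using Gamma_mat_mult[OF Gamma_mat_adjugate[OF A] B]
    by (simp add: mat2_mult k_def l_def algebra_simps)
  then have row: "orbit_row (- k) l"
    using Gamma_mat_orbit_row(2) Gamma_mat_adjugate by blast
  \<comment> \<open>This recovers the second matrix as the first one times the product just formed,
    read off at the lower left entry.\<close>
  have c': "c' = c * l + d * k"
  proof -
    have "c * l + d * k = (a * d - b * c) * c'"
      by (simp add: k_def l_def algebra_simps)
    with det show ?thesis by simp
  qed
  have "2 * \<bar>real_of_int c * of_int c'\<bar> < T * \<bar>of_int k\<bar>"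
  proof (cases "\<bar>k\<bar> = 1")
    case True
    then obtain n where n: "l = 4 * n"
      using orbit_row_unit_dvd[OF row] by (auto elim: dvdE)
    from True have k2: "k * k = 1" by (auto simp: abs_if split: if_splits)
    \<comment> \<open>The multiplier \<open>k * n\<close> comes from multiplying
      \<open>c' = c * l + d * k\<close> by \<open>k\<close>, where \<open>k * k = 1\<close> and
      \<open>l = 4 * n\<close>: the row \<open>(c, k * c')\<close> is a translate of the row
      \<open>(c, d)\<close>.\<close>
    have "orbit_row c (d + 4 * (k * n) * c)"
      using orbit_row_translate Gamma_mat_orbit_row(2)[OF A] by blast
    also have "d + 4 * (k * n) * c = (k * k) * d + 4 * (k * n) * c"
      by (simp add: k2)
    also have "\<dots> = k * c'"
      by (simp add: c' n algebra_simps)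
    finally have "orbit_row c (k * c')" .
    moreover have "(real_of_int (k * c'))\<^sup>2 = (of_int c')\<^sup>2"
      using True by (auto simp: abs_if split: if_splits)
    ultimately have "2 * \<bar>real_of_int c * of_int (k * c')\<bar> < T"
      using T by (intro orbit_row_mult_less) auto
    moreover have "\<bar>real_of_int k\<bar> = 1"
      using True by linarith
    ultimately show ?thesis
      by (simp add: abs_mult)
  next
    case False
    \<comment> \<open>\<open>k\<close> is a nonzero integer. For \<open>|k|\<close> at least 2, the
      inequality of arithmetic and geometric means is enough.\<close>
    with ne have "2 \<le> \<bar>k\<bar>" by (simp add: k_def)
    then have k: "2 \<le> \<bar>real_of_int k\<bar>" by linarith
    have "2 * \<bar>real_of_int c * of_int c'\<bar> \<le> (of_int c)\<^sup>2 + (of_int c')\<^sup>2"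
      using sum_squares_bound[of "\<bar>real_of_int c\<bar>" "\<bar>of_int c'\<bar>"] by (simp add: abs_mult)
    also have "\<dots> < T * 2"
      using T by simp
    also have "\<dots> \<le> T * \<bar>of_int k\<bar>"
      using k T(1) zero_le_power2[of "real_of_int c"] by (intro mult_left_mono) linarith+
    finally show ?thesis .
  qed
  then show ?thesis by (simp add: k_def)
qed

section \<open>Moebius images of the base circles, reduced to the orbit of \<open>C1\<close>\<close>

section \<open>Circles of the packing\<close>

text \<open>Homogeneous coordinates on the Riemann sphere, in which Moebius maps are linear. The
  pair \<open>(0, 0)\<close> represents no point but receives the value \<open>None\<close>, so uses
  of \<open>ratio\<close> must exclude it.\<close>

definition ratio :: "complex \<Rightarrow> complex \<Rightarrow> complex option" where
  "ratio n w = (if w = 0 then None else Some (n / w))"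

lemma moebius_ratio:
  fixes n w :: complex
  assumes "n \<noteq> 0 \<or> w \<noteq> 0"
  shows "moebius A (ratio n w) =
    ratio (of_real (A$1$1) * n + of_real (A$1$2) * w) (of_real (A$2$1) * n + of_real (A$2$2) * w)"
proof (cases "w = 0")
  case True
  with assms show ?thesis by (simp add: ratio_def moebius_def Let_def)
next
  case False
  then have eq: "x * (n / w) + y = (x * n + y * w) / w" for x y
    by (simp add: field_simps)
  show ?thesis
    using False by (simp add: ratio_def moebius_def Let_def eq del: times_divide_eq_right)
qed

lemma moebius_mult:
  assumes "det B \<noteq> 0"
  shows "moebius A (moebius B p) = moebius (A ** B) p"
proof -
  obtain n w where p: "p = ratio n w" "n \<noteq> 0 \<or> w \<noteq> 0"
  proof (cases p)
    case None
    then show thesis using that[of 1 0] by (simp add: ratio_def)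
  next
    case (Some z)
    then show thesis using that[of z 1] by (simp add: ratio_def)
  qed
  let ?n = "of_real (B$1$1) * n + of_real (B$1$2) * w"
  let ?w = "of_real (B$2$1) * n + of_real (B$2$2) * w"
  have "?n \<noteq> 0 \<or> ?w \<noteq> 0"
  proof (rule ccontr)
    assume "\<not> ?thesis"
    then have 0: "?n = 0" "?w = 0" by auto
    \<comment> \<open>Cramer's rule: a nonsingular matrix sends no nonzero vector to 0.\<close>
    have "of_real (det B) * n = of_real (B$2$2) * ?n - of_real (B$1$2) * ?w"
      "of_real (det B) * w = of_real (B$1$1) * ?w - of_real (B$2$1) * ?n"
      by (simp_all add: det_2 algebra_simps)
    with 0 assms p(2) show False by simp
  qed
  then show ?thesis
    using p by (simp add: moebius_ratio matrix_matrix_mult_def sum_2 algebra_simps)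
qed

lemma mem_sphere_C2_iff: "w \<in> sphere (\<i> / 2) (1 / 2) \<longleftrightarrow> (Re w)\<^sup>2 + (Im w)\<^sup>2 = Im w"
proof -
  have "w \<in> sphere (\<i> / 2) (1 / 2) \<longleftrightarrow> sqrt ((Re w)\<^sup>2 + (1 / 2 - Im w)\<^sup>2) = sqrt ((1 / 2)\<^sup>2)"
    by (simp add: dist_norm cmod_def)
  also have "\<dots> \<longleftrightarrow> (Re w)\<^sup>2 + (Im w)\<^sup>2 = Im w"
    unfolding real_sqrt_eq_iff by (auto simp: power2_eq_square algebra_simps)
  finally show ?thesis .
qed

text \<open>The map is \<open>z \<mapsto> -1/z\<close>. The image has squared modulus
  \<open>1 / |z|^2\<close> and imaginary part \<open>Im z / |z|^2\<close>; these agree when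
  \<open>Im z = 1\<close>, which is the equation of \<open>C2\<close>. Infinity goes to 0.\<close>

lemma inversion_image_C1: "moebius (mat2 0 1 (-1) 0) ` C1 = C2"
proof (intro equalityI subsetI)
  fix p assume "p \<in> moebius (mat2 0 1 (-1) 0) ` C1"
  then consider "p = Some 0" | z where "Im z = 1" "p = Some (1 / (- z))"
    by (auto simp: C1_def hline_def moebius_def split: if_splits)
  then show "p \<in> C2"
  proof cases
    case 1
    then show ?thesis
      unfolding C2_def circ_def using mem_sphere_C2_iff[of 0] by simp
  next
    case 2
    have "(Re (1 / (- z)))\<^sup>2 + (Im (1 / (- z)))\<^sup>2 = 1 / ((Re z)\<^sup>2 + (Im z)\<^sup>2)"
      unfolding cmod_power2[symmetric] by (simp add: norm_divide power_divide)
    also have "\<dots> = Im (1 / (- z))"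
      using 2(1) by (simp add: Im_divide)
    finally have "(Re (1 / (- z)))\<^sup>2 + (Im (1 / (- z)))\<^sup>2 = Im (1 / (- z))" .
    with 2(2) show ?thesis
      unfolding C2_def circ_def by (simp only: mem_sphere_C2_iff image_eqI)
  qed
next
  fix p assume "p \<in> C2"
  then obtain w where w: "p = Some w" "(Re w)\<^sup>2 + (Im w)\<^sup>2 = Im w"
    unfolding C2_def circ_def using mem_sphere_C2_iff by blast
  show "p \<in> moebius (mat2 0 1 (-1) 0) ` C1"
  proof (cases "w = 0")
    case True
    with w(1) show ?thesis
      by (intro image_eqI[of _ _ None]) (simp_all add: moebius_def C1_def hline_def)
  next
    case False
    then have "(Re w)\<^sup>2 + (Im w)\<^sup>2 \<noteq> 0"
      by (simp add: complex_eq_iff sum_power2_eq_zero_iff)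
    then have "Im (- 1 / w) = 1"
      using w(2) by (simp add: Im_divide)
    with False w(1) show ?thesis
      by (intro image_eqI[of _ _ "Some (- 1 / w)"]) (auto simp: moebius_def C1_def hline_def)
  qed
qed

lemma translation_image_C2: "moebius (mat2 1 4 0 1) ` C2 = C3"
proof -
  have "(\<lambda>z. z + 4) ` sphere (\<i> / 2) (1 / 2) = sphere (4 + \<i> / 2) (1 / 2)"
    using sphere_translation[of 4 "\<i> / 2" "1 / 2"] by (simp add: add.commute)
  moreover have "moebius (mat2 1 4 0 1) ` C2 = Some ` (\<lambda>z. z + 4) ` sphere (\<i> / 2) (1 / 2)"
    unfolding C2_def circ_def image_image by (simp add: moebius_def)
  ultimately show ?thesis
    by (simp add: C3_def circ_def)
qed

text \<open>A circle of positive radius contains the two distinct points \<open>z + r\<close> and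
  \<open>z - r\<close>, so it is not a single point. This rules out images of \<open>C0\<close> as
  tangent circles.\<close>

lemma circ_not_subset_C0:
  assumes "0 < r" "circ z r \<inter> C0 = {p}"
  shows "\<not> circ z r \<subseteq> C0"
proof
  assume "circ z r \<subseteq> C0"
  with assms(2) have "circ z r = {p}" by blast
  moreover have "Some (z + of_real r) \<in> circ z r" "Some (z - of_real r) \<in> circ z r"
    using assms(1) by (simp_all add: circ_def dist_norm)
  ultimately have "z + of_real r = z - of_real r"
    by (metis option.inject singletonD)
  with assms(1) show False by (simp add: complex_eq_iff)
qed

lemma moebius_image_C0: "moebius A ` C0 \<subseteq> C0"
proof -
  have "moebius A (Some z) \<in> C0" if "Im z = 0" for z
  proof -
    have "z = of_real (Re z)"
      using that by (simp add: complex_eq_iff)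
    then obtain x where x: "z = of_real x" ..
    show ?thesis
      by (simp add: x moebius_def C0_def hline_def Let_def Im_divide)
  qed
  moreover have "moebius A None \<in> C0"
    by (simp add: moebius_def C0_def hline_def Let_def Im_divide)
  ultimately show ?thesis
    by (auto simp: C0_def hline_def)
qed

text \<open>\<open>C2\<close> is the inverted \<open>C1\<close>, and \<open>C3\<close> is a
  translate of \<open>C2\<close>, so their orbits lie in the orbit of \<open>C1\<close>; images of
  \<open>C0\<close> stay inside \<open>C0\<close>.\<close>

lemma packing_circle_cases:
  assumes "circ z r \<in> packing"
  obtains "circ z r \<subseteq> C0" | A where "A \<in> Gamma_mat" "circ z r = moebius A ` C1"
proof -
  obtain A C where A: "A \<in> Gamma_mat" and C: "C \<in> {C0, C1, C2, C3}"
    and eq: "circ z r = moebius A ` C"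
    using assms unfolding packing_def Gamma_hat_eq by (force simp: psl_act_psl)
  have det: "det A \<noteq> 0" if "A \<in> Gamma_mat" for A
    using subgroup.mem_carrier[OF subgroup_Gamma_mat that] by (simp add: SL2R_def)
  have mult: "moebius A ` moebius B ` D = moebius (A ** B) ` D"
    if "A \<in> Gamma_mat" "B \<in> Gamma_mat" for A B D
    using that by (simp add: image_image moebius_mult det)
  let ?S = "mat2 0 1 (-1) 0" and ?T = "mat2 1 4 0 1"
  have 2: "moebius A ` C2 = moebius (A ** ?S) ` C1"
    if "A \<in> Gamma_mat" for A
    using mult[OF that inversion_in_Gamma_mat, of C1] by (simp add: inversion_image_C1)
  have 3: "moebius A ` C3 = moebius (A ** ?T) ` C2"
    using mult[OF A translation_in_Gamma_mat, of C2] by (simp add: translation_image_C2)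
  from C consider "C = C0" | "C = C1" | "C = C2" | "C = C3" by blast
  then show thesis
  proof cases
    case 1
    with eq that(1) show thesis using moebius_image_C0[of A] by simp
  next
    case 2
    with eq A that(2) show thesis by blast
  next
    case 3
    with eq A that(2) 2[OF A] show thesis
      by (metis Gamma_mat_mult inversion_in_Gamma_mat)
  next
    case 4
    with eq A that(2) 3 2[of "A ** ?T"] show thesis
      by (metis Gamma_mat_mult inversion_in_Gamma_mat translation_in_Gamma_mat)
  qed
qed

text \<open>The image of the line \<open>Im = 1\<close> is a horocycle based at
  \<open>a / c\<close>, the image of infinity. Since \<open>circ z r\<close> omits infinity,
  \<open>c\<close> cannot vanish.\<close>

lemma horocycle_diameter:
  assumes det: "a * d - b * c = 1" and r: "0 < r"
    and eq: "circ z r = moebius (mat2 a b c d) ` C1"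
  shows "c \<noteq> 0" "Some (of_real (a / c)) \<in> circ z r" "2 * r \<le> 1 / c\<^sup>2"
proof -
  have top: "moebius (mat2 a b c d) None \<in> circ z r"
    unfolding eq by (rule imageI) (simp add: C1_def hline_def)
  then show c: "c \<noteq> 0"
    by (auto simp: moebius_def circ_def)
  with top show tip: "Some (of_real (a / c)) \<in> circ z r"
    by (simp add: moebius_def)
  have near: "cmod (w - of_real (a / c)) \<le> 1 / c\<^sup>2"
    if "Some w \<in> moebius (mat2 a b c d) ` C1" for w
  proof -
    from that obtain p where p: "p \<in> C1" "moebius (mat2 a b c d) p = Some w"
      by force
    show ?thesis
    proof (cases p)
      case None
      with p c show ?thesis by (auto simp: moebius_def)
    next
      case (Some u)
      with p have u: "Im u = 1" and nz: "of_real c * u + of_real d \<noteq> 0"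
        and w: "w = (of_real a * u + of_real b) / (of_real c * u + of_real d)"
        by (auto simp: moebius_def C1_def hline_def Let_def split: if_splits)
      \<comment> \<open>The distance to the base point is \<open>1 / (|c| |c * u + d|)\<close>, and
        \<open>|c * u + d|\<close> is at least its imaginary part in absolute value, which is
        \<open>|c|\<close> because \<open>Im u = 1\<close>.\<close>
      have "w - of_real (a / c) = - of_real (a * d - b * c) / (of_real c * (of_real c * u + of_real d))"
        unfolding w using c nz by (simp add: divide_simps) (simp add: algebra_simps)
      then have "cmod (w - of_real (a / c)) = 1 / (\<bar>c\<bar> * cmod (of_real c * u + of_real d))"
        by (simp add: det norm_divide norm_mult)
      also have "\<dots> \<le> 1 / (\<bar>c\<bar> * \<bar>c\<bar>)"
        using abs_Im_le_cmod[of "of_real c * u + of_real d"] c u nz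
        by (intro divide_left_mono mult_left_mono mult_pos_pos) auto
      finally show ?thesis by (simp add: power2_eq_square)
    qed
  qed
  have r_eq: "cmod (z - of_real (a / c)) = r"
    using tip by (auto simp: circ_def dist_norm)
  \<comment> \<open>The antipode of the base point lies at distance exactly \<open>2 * r\<close>
    from it.\<close>
  have "Some (2 * z - of_real (a / c)) \<in> circ z r"
    using r_eq by (auto simp: circ_def dist_norm norm_minus_commute)
  then have "cmod (2 * z - of_real (a / c) - of_real (a / c)) \<le> 1 / c\<^sup>2"
    unfolding eq by (rule near)
  also have "2 * z - of_real (a / c) - of_real (a / c) = 2 * (z - of_real (a / c))"
    by simp
  finally show "2 * r \<le> 1 / c\<^sup>2"
    using r_eq by (simp only: norm_mult norm_numeral)
qed

section \<open>Tangency points as fractions, and the gaps between them\<close>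

lemma tangencies_fraction:
  assumes "0 < T" "x \<in> tangencies T"
  obtains a b c d :: int where
    "mat2 (of_int a) (of_int b) (of_int c) (of_int d) \<in> Gamma_mat"
    "c \<noteq> 0" "x = of_int a / of_int c" "(of_int c)\<^sup>2 < T"
proof -
  obtain z r where r: "0 < r" "circ z r \<in> packing" "1 / T < 2 * r"
    and tan: "circ z r \<inter> C0 = {Some (of_real x)}"
    using assms(2) by (auto simp: tangencies_def tangent_at_def)
  from packing_circle_cases[OF r(2)] obtain A where A: "A \<in> Gamma_mat" "circ z r = moebius A ` C1"
    using circ_not_subset_C0[OF r(1) tan] by blast
  from Gamma_mat_integral[OF A(1)] obtain a b c d :: int where
    abcd: "A = mat2 (of_int a) (of_int b) (of_int c) (of_int d)" "a * d - b * c = 1"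
    by metis
  have "real_of_int a * of_int d - of_int b * of_int c = 1"
    using arg_cong[OF abcd(2), of real_of_int] by simp
  note hor = horocycle_diameter[OF this r(1) A(2)[unfolded abcd(1)]]
  \<comment> \<open>The base point of the horocycle is real, so it is the unique common point with
    \<open>C0\<close>.\<close>
  have "Some (complex_of_real (of_int a / of_int c)) \<in> circ z r \<inter> C0"
    using hor(2) by (simp add: C0_def hline_def)
  then have x: "x = of_int a / of_int c"
    unfolding tan by (metis of_real_eq_iff option.inject singletonD)
  have "1 / T < 1 / (of_int c)\<^sup>2"
    using r(3) hor(3) by linarith
  then have "(of_int c)\<^sup>2 < T"
    using assms(1) hor(1) by (simp add: field_simps)
  with that A(1) abcd(1) hor(1) x show thesis by auto
qed

lemma tangencies_gap:
  assumes T: "0 < T" and xy: "x \<in> tangencies T" "y \<in> tangencies T" "x < y"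
  shows "2 < T * (y - x)"
proof -
  obtain a b c d :: int where 1: "mat2 (of_int a) (of_int b) (of_int c) (of_int d) \<in> Gamma_mat"
    "c \<noteq> 0" "x = of_int a / of_int c" "(of_int c)\<^sup>2 < T"
    using tangencies_fraction[OF T xy(1)] by metis
  obtain a' b' c' d' :: int where 2:
    "mat2 (of_int a') (of_int b') (of_int c') (of_int d') \<in> Gamma_mat"
    "c' \<noteq> 0" "y = of_int a' / of_int c'" "(of_int c')\<^sup>2 < T"
    using tangencies_fraction[OF T xy(2)] by metis
  have pos: "0 < \<bar>real_of_int c * of_int c'\<bar>"
    using 1(2) 2(2) by simp
  have diff: "x - y = of_int (a * c' - a' * c) / (of_int c * of_int c')"
    unfolding 1(3) 2(3) using 1(2) 2(2) by (simp add: diff_frac_eq)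
  have "a * c' \<noteq> a' * c"
    using xy(3) diff by (metis diff_self div_0 less_irrefl of_int_0 right_minus_eq)
  from Gamma_mat_gap[OF 1(1) 2(1) 1(4) 2(4) this]
  have "2 < T * (\<bar>of_int (a * c' - a' * c)\<bar> / \<bar>real_of_int c * of_int c'\<bar>)"
    using pos by (simp add: field_simps)
  also have "\<bar>of_int (a * c' - a' * c)\<bar> / \<bar>real_of_int c * of_int c'\<bar> = \<bar>x - y\<bar>"
    unfolding diff by (rule abs_divide[symmetric])
  finally show ?thesis
    using xy(3) by simp
qed

lemma tangency_gap:
  assumes "0 < T" "1 \<le> j" "j < card (tangencies_in T I)"
  shows "2 < T * (tangency T I (j + 1) - tangency T I j)"
proof -
  let ?X = "tangencies_in T I" and ?l = "sorted_list_of_set (tangencies_in T I)"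
  \<comment> \<open>An infinite set has \<open>card\<close> equal to 0, which would leave no room
    for \<open>j\<close>.\<close>
  have fin: "finite ?X"
    using assms(3) card.infinite by fastforce
  \<comment> \<open>The tangency points count from 1 but list positions from 0, so the points
    \<open>j\<close> and \<open>j + 1\<close> sit at positions \<open>j - 1\<close> and
    \<open>j\<close>.\<close>
  have j: "j - 1 < j" "j < length ?l"
    using assms by simp_all
  then have "?l ! (j - 1) < ?l ! j"
    using sorted_wrt_nth_less[OF strict_sorted_list_of_set] by blast
  moreover have "?l ! (j - 1) \<in> ?X" "?l ! j \<in> ?X"
    using j nth_mem[of _ ?l] set_sorted_list_of_set[OF fin] by (metis less_trans)+
  ultimately show ?thesis
    using assms(1) by (auto simp: tangency_def tangencies_in_def intro: tangencies_gap)
qed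

theorem proposition8p8:
  shows "(\<forall>a b s. 0 \<le> a \<and> a \<le> b \<and> b \<le> 1 \<and> 0 < s \<and> s < 2 \<longrightarrow>
            ((\<lambda>T. gap_distr T {a..b} s) \<longlongrightarrow> 0) at_top)
       \<and> (\<forall>T I j. 0 < T \<and> is_interval I \<and> I \<subseteq> {0..1} \<and>
            1 \<le> j \<and> j < card (tangencies_in T I) \<longrightarrow>
            T * (tangency T I (j + 1) - tangency T I j) > 2)"
proof (intro conjI allI impI)
  fix a b s :: real
  assume "0 \<le> a \<and> a \<le> b \<and> b \<le> 1 \<and> 0 < s \<and> s < 2"
  then have "s < 2" by simp
  \<comment> \<open>Every scaled gap exceeds 2 and hence \<open>s\<close>, so nothing is counted;
    the function is exactly 0 for each positive \<open>T\<close>, not merely in the limit.\<close>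
  have "gap_distr T {a..b} s = 0" if "0 < T" for T
  proof -
    have "{j \<in> {1..<card (tangencies_in T {a..b})}.
        T * (tangency T {a..b} (j + 1) - tangency T {a..b} j) \<le> s} = {}"
      using tangency_gap[OF that, of _ "{a..b}"] \<open>s < 2\<close> by fastforce
    then show ?thesis
      unfolding gap_distr_def by simp
  qed
  then have "\<forall>\<^sub>F T in at_top. gap_distr T {a..b} s = 0"
    using eventually_gt_at_top[of "0::real"] by (rule eventually_mono[rotated])
  then show "((\<lambda>T. gap_distr T {a..b} s) \<longlongrightarrow> 0) at_top"
    by (rule tendsto_eventually)
qed (use tangency_gap in blast)

end
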